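(* The following assertion is false: there exist constants $C_1,C_2>0$ and $\alpha\ge 2$, all independent of $n$, such that for every odd prime $n$ the inequality $$T_n(\kappa)> C_1\frac{(\log n)^{\alpha}}{n}$$ holds for at most $C_2(\log n)^{\alpha}$ values of $\kappa$ among $\{1,\ldots,n-1\}$.
   Context: Here $\log$ is the natural logarithm. For an odd prime $n$ and an integer $j$, let $r(j,n)$ denote the unique integer congruent to $j$ modulo $n$ in the set $\{-(n-1)/2,\ldots,(n-1)/2\}$. For $\kappa\in\{1,\ldots,n-1\}$, define $$T_n(\kappa):=\sum_{q=1}^{(n-1)/2}\frac{1}{q\,|r(q\kappa,n)|}.$$ *)

theory Defs
  imports Complex_Main "HOL-Number_Theory.Cong"
begin

definition abs_least_residue :: "int \<Rightarrow> nat \<Rightarrow> int" where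
  "abs_least_residue j n =
     (THE r. r \<in> {- ((int n - 1) div 2) .. (int n - 1) div 2} \<and> [r = j] (mod int n))"

lemma ex1_abs_least_residue:
  assumes "odd n"
  shows "\<exists>!r. r \<in> {- ((int n - 1) div 2) .. (int n - 1) div 2} \<and> [r = j] (mod int n)"
proof -
  obtain k where k: "n = 2 * k + 1"
    using assms by (rule oddE)
  have m: "(int n - 1) div 2 = int k"
    using k by simp
  have n: "int n = 2 * int k + 1" "int n > 0"
    using k by simp_all
  show ?thesis
  proof (rule ex1I)
    let ?r = "(j + int k) mod int n - int k"
    have "0 \<le> (j + int k) mod int n" "(j + int k) mod int n < int n"
      using n(2) by simp_all
    moreover have "[?r = j] (mod int n)"
      by (simp add: cong_def mod_diff_left_eq)
    ultimately show "?r \<in> {- ((int n - 1) div 2) .. (int n - 1) div 2} \<and> [?r = j] (mod int n)"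
      unfolding m using n(1) by auto
  next
    fix r assume r: "r \<in> {- ((int n - 1) div 2) .. (int n - 1) div 2} \<and> [r = j] (mod int n)"
    then have "[r + int k = j + int k] (mod int n)"
      by (simp add: cong_add_rcancel)
    moreover have "0 \<le> r + int k" "r + int k < int n"
      using r n(1) unfolding m by auto
    ultimately show "r = (j + int k) mod int n - int k"
      by (simp add: cong_def)
  qed
qed

definition T :: "nat \<Rightarrow> nat \<Rightarrow> real" where
  "T n \<kappa> = (\<Sum>q = 1..(n - 1) div 2.
     1 / (real q * \<bar>real_of_int (abs_least_residue (int (q * \<kappa>)) n)\<bar>))"

end

theory Submission
  imports Defs "HOL-Real_Asymp.Real_Asymp"
begin

text \<open>
  The claimed bound fails because already the single summand \<open>q = 1\<close> makes \<open>T n \<kappa>\<close> large for far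
  too many \<open>\<kappa>\<close>. If \<open>1 \<le> \<kappa> \<le> (n - 1) / 2\<close>, then \<open>\<kappa>\<close> is its own absolutely least residue, so
  \<open>T n \<kappa> \<ge> 1 / \<kappa>\<close> (lemma \<open>T_ge_inverse\<close>). Hence, for large \<open>n\<close>, all \<open>\<kappa>\<close> below
  \<open>n / (C\<^sub>1 (ln n)\<^sup>\<alpha>)\<close> exceed the threshold. That is a number of values almost linear in \<open>n\<close>; the
  proof keeps only those up to \<open>\<surd>n\<close>, which outnumber every power of \<open>ln n\<close> once the prime \<open>n\<close> is
  large, whatever the constants are.
\<close>

lemma abs_least_residue_eq_self:
  assumes "odd n" "\<bar>j\<bar> \<le> (int n - 1) div 2"
  shows "abs_least_residue j n = j"
  unfolding abs_least_residue_def
  by (rule the1_equality[OF ex1_abs_least_residue[OF assms(1)]]) (use assms(2) in auto)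

lemma T_ge_inverse:
  assumes "odd n" "1 \<le> \<kappa>" "\<kappa> \<le> (n - 1) div 2"
  shows "T n \<kappa> \<ge> 1 / real \<kappa>"
proof -
  let ?f = "\<lambda>q. 1 / (real q * \<bar>real_of_int (abs_least_residue (int (q * \<kappa>)) n)\<bar>)"
  have "int \<kappa> \<le> (int n - 1) div 2"
    using assms by linarith
  then have "?f 1 = 1 / real \<kappa>"
    using abs_least_residue_eq_self[OF assms(1), of "int \<kappa>"] by simp
  moreover have "?f 1 \<le> (\<Sum>q = 1..(n - 1) div 2. ?f q)"
    using assms by (intro member_le_sum) auto
  ultimately show ?thesis
    by (simp add: T_def)
qed

theorem theorem1:
  shows "\<not> (\<exists>(C1::real) (C2::real) (\<alpha>::real). C1 > 0 \<and> C2 > 0 \<and> \<alpha> \<ge> 2 \<and>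
    (\<forall>n::nat. prime n \<and> odd n \<longrightarrow>
      real (card {\<kappa> \<in> {1..n - 1}. T n \<kappa> > C1 * (ln (real n) powr \<alpha>) / real n})
        \<le> C2 * ln (real n) powr \<alpha>))"
proof (intro notI, elim exE conjE)
  fix C1 C2 \<alpha> :: real
  assume pos: "C1 > 0" "C2 > 0" "\<alpha> \<ge> 2"
    and bound: "\<forall>n::nat. prime n \<and> odd n \<longrightarrow>
      real (card {\<kappa> \<in> {1..n - 1}. T n \<kappa> > C1 * (ln (real n) powr \<alpha>) / real n})
        \<le> C2 * ln (real n) powr \<alpha>"
  \<comment> \<open>The summand \<open>1\<close> in the second condition absorbs the loss from rounding \<open>\<surd>n\<close> down.\<close>
  have "eventually (\<lambda>n::nat. C1 * ln (real n) powr \<alpha> * sqrt (real n) < real n \<and>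
          C2 * ln (real n) powr \<alpha> + 1 < sqrt (real n) \<and> sqrt (real n) \<le> (real n - 1) / 2) at_top"
    using pos by (intro eventually_conj; real_asymp)
  then obtain N where N: "\<And>n. n \<ge> N \<Longrightarrow> C1 * ln (real n) powr \<alpha> * sqrt (real n) < real n \<and>
          C2 * ln (real n) powr \<alpha> + 1 < sqrt (real n) \<and> sqrt (real n) \<le> (real n - 1) / 2"
    by (auto simp: eventually_at_top_linorder)
  obtain n where n: "prime n" "n > max N 2"
    using bigger_prime by blast
  have "odd n"
    using n prime_odd_nat by auto
  define P where "P = ln (real n) powr \<alpha>"
  have C1: "C1 * P * sqrt (real n) < real n" and C2: "C2 * P + 1 < sqrt (real n)"
    and half: "sqrt (real n) \<le> (real n - 1) / 2"
    using N[of n] n by (auto simp: P_def)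
  define m where "m = nat \<lfloor>sqrt (real n)\<rfloor>"
  have m: "real m \<le> sqrt (real n)" "sqrt (real n) < real m + 1"
    unfolding m_def by (simp_all add: of_nat_floor)
  have m_half: "m \<le> (n - 1) div 2"
  proof -
    have "real (2 * m + 1) \<le> real n"
      using m(1) half by simp
    then show ?thesis
      by linarith
  qed
  have "T n \<kappa> > C1 * P / real n" if \<kappa>: "\<kappa> \<in> {1..m}" for \<kappa>
  proof -
    have "C1 * P * real \<kappa> \<le> C1 * P * sqrt (real n)"
      using \<kappa> m(1) pos by (intro mult_left_mono) (auto simp: P_def)
    then have "C1 * P / real n < 1 / real \<kappa>"
      using C1 \<kappa> n by (simp add: field_simps)
    also have "\<dots> \<le> T n \<kappa>"
      using \<kappa> m_half \<open>odd n\<close> by (intro T_ge_inverse) auto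
    finally show ?thesis .
  qed
  then have "{1..m} \<subseteq> {\<kappa> \<in> {1..n - 1}. T n \<kappa> > C1 * P / real n}"
    using m_half by auto
  then have "m \<le> card {\<kappa> \<in> {1..n - 1}. T n \<kappa> > C1 * P / real n}"
    using card_mono[of "{\<kappa> \<in> {1..n - 1}. T n \<kappa> > C1 * P / real n}" "{1..m}"] by simp
  moreover have "real (card {\<kappa> \<in> {1..n - 1}. T n \<kappa> > C1 * P / real n}) \<le> C2 * P"
    using bound n(1) \<open>odd n\<close> unfolding P_def by blast
  ultimately show False
    using C2 m(2) by linarith
qed

end
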